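(* If $\Gamma\vdash u:\sigma$ in the source language (System T extended by the constant $\Omega$), then $\Gamma\vdash\widehat u:\sigma$ in the auxiliary infinitary language, and for every valuation $\gamma$ for $\Gamma$, $$[\![\widehat u]\!]^\infty_\gamma=[\![u]\!]^D_\gamma .$$
   Context: **Source language.** Simple types: $\sigma,\tau::=\iota\mid\sigma\to\tau$ (arrows associate to the right). Terms are simply typed $\lambda$-terms (variables, abstractions, applications), up to renaming of bound variables, over the constants $\mathsf 0:\iota$, $\mathsf{succ}:\iota\to\iota$, $\mathsf{Rec}_\sigma:(\iota\to\sigma\to\sigma)\to\sigma\to\iota\to\sigma$ for every type $\sigma$ (System T), together with $\Omega:\iota\to\iota$. Contexts are finite lists of distinct typed variables. **Dialogue trees.** For a set $X$, $\mathcal D(X)$ is inductively generated by leaves $\eta(x)$ ($x\in X$) and nodes $\beta_i(\varphi)$ ($i\in\mathbb N$, $\varphi:\mathbb N\to\mathcal D(X)$). Grafting, for $d\in\mathcal D(X)$ and $g:X\to\mathcal D(Y)$: $\eta(x)\gg\!\!=g\;=\;g(x)$ and $\beta_i(\varphi)\gg\!\!=g\;=\;\beta_i(n\mapsto\varphi(n)\gg\!\!=g)$. Put $\mathrm{map}(f,d)=d\gg\!\!=(x\mapsto\eta(f(x)))$. **Dialogue interpretation.** $V_\iota=\mathcal D(\mathbb N)$, $V_{\sigma\to\tau}=V_\sigma\to V_\tau$. A valuation $\gamma$ for $\Gamma$ assigns $\gamma(x)\in V_\sigma$ to each $x:\sigma$ in $\Gamma$. Typed grafting, for $d\in\mathcal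 D(X)$ and $g:X\to V_\sigma$: $d\gg\!\!=_\iota g=d\gg\!\!=g$, and $(d\gg\!\!=_{\sigma\to\tau}g)(a)=d\gg\!\!=_\tau(x\mapsto g(x)(a))$. $[\![u]\!]^D_\gamma\in V_\sigma$ is defined by $[\![x]\!]^D_\gamma=\gamma(x)$; $[\![\lambda x^\sigma.t]\!]^D_\gamma(a)=[\![t]\!]^D_{\gamma[x\mapsto a]}$; $[\![t\,u]\!]^D_\gamma=[\![t]\!]^D_\gamma([\![u]\!]^D_\gamma)$; $[\![\mathsf 0]\!]^D=\eta(0)$; $[\![\mathsf{succ}]\!]^D(d)=\mathrm{map}(n\mapsto n+1,d)$; $[\![\mathsf{Rec}_\sigma]\!]^D(f)(a)(d)=d\gg\!\!=_\sigma(n\mapsto v_n)$, where $v_0=a$, $v_{n+1}=f(\eta(n))(v_n)$; and $[\![\Omega]\!]^D=\mathsf{gen}$, where $\mathsf{gen}(d)=d\gg\!\!=(i\mapsto\beta_i(n\mapsto\eta(n)))$. **Auxiliary (infinitary) terms.** Same types and contexts. Terms are inductively generated (so well-founded, possibly countably branching), up to renaming of bound variables, by variables, abstraction, application with the usual typing, literals $\Gamma\vdash\underline n:\iota$ ($n\in\mathbb N$), queries $\Gamma\vdash\mathsf{query}_i(n\mapsto M_n):\iota$ for $i\in\mathbb N$ and a family $(M_n)_{n\in\mathbb N}$ with $\Gamma\vdash M_n:\iota$, and selections $\Gamma\vdash\mathsf{case}(M;\,n\mapsto M_n):\iota$ for $\Gamma\vdash M:\iota$ and $\Gamma\vdash M_n:\iota$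 for all $n$. Semantics $[\![M]\!]^\infty_\gamma\in V_\sigma$: variables, abstraction, application as for $[\![\cdot]\!]^D$; $[\![\underline n]\!]^\infty_\gamma=\eta(n)$; $[\![\mathsf{query}_i(n\mapsto M_n)]\!]^\infty_\gamma=\beta_i(n\mapsto[\![M_n]\!]^\infty_\gamma)$; $[\![\mathsf{case}(M;n\mapsto M_n)]\!]^\infty_\gamma=[\![M]\!]^\infty_\gamma\gg\!\!=(n\mapsto[\![M_n]\!]^\infty_\gamma)$. **Derived selection.** For $M:\iota$ and $M_n:\sigma$ ($n\in\mathbb N$) in context $\Gamma$: $\mathsf{case}_\iota(M;n\mapsto M_n)=\mathsf{case}(M;n\mapsto M_n)$; $\mathsf{case}_{\sigma\to\tau}(M;n\mapsto M_n)=\lambda x^\sigma.\mathsf{case}_\tau(M;n\mapsto M_n\,x)$ with $x$ fresh. **Translation $u\mapsto\widehat u$.** Let $I_0(f,a)=a$, $I_{n+1}(f,a)=f\,\underline n\,(I_n(f,a))$, and $R^\infty_\sigma=\lambda f^{\iota\to\sigma\to\sigma}\,a^\sigma\,z^\iota.\,\mathsf{case}_\sigma(z;\,n\mapsto I_n(f,a))$. Then $\widehat{\mathsf 0}=\underline 0$; $\widehat{\mathsf{Rec}_\sigma}=R^\infty_\sigma$; $\widehat{\mathsf{succ}}=\lambda z^\iota.\mathsf{case}(z;n\mapsto\underline{n+1})$; $\widehat\Omega=\lambda z^\iota.\mathsf{case}(z;i\mapsto\mathsf{query}_i(n\mapsto\underline n))$; $\widehat x=x$; $\widehat{\lambda x^\sigma.u}=\lambda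 x^\sigma.\widehat u$; $\widehat{u\,v}=\widehat u\,\widehat v$. *)

theory Defs
  imports Main "HOL-Library.FuncSet"
begin

section \<open>Types and source terms\<close>

datatype ty = Iota (\<open>\<iota>\<close>) | Fun ty ty (infixr \<open>\<leadsto>\<close> 65)

text \<open>Terms up to renaming of bound variables are represented with de Bruijn indices. A context is
  the list of the types of its variables; index 0 is the head, i.e. the most recently bound one.\<close>

datatype src =
    Var nat
  | Abs ty src
  | App src src
  | Zero
  | Succ
  | Rec ty
  | Omega

fun const_ty :: "src \<Rightarrow> ty" where
  "const_ty Succ = \<iota> \<leadsto> \<iota>"
| "const_ty (Rec \<sigma>) = (\<iota> \<leadsto> \<sigma> \<leadsto> \<sigma>) \<leadsto> \<sigma> \<leadsto> \<iota> \<leadsto> \<sigma>"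
| "const_ty Omega = \<iota> \<leadsto> \<iota>"
| "const_ty _ = \<iota>"

inductive src_typing :: "ty list \<Rightarrow> src \<Rightarrow> ty \<Rightarrow> bool" (\<open>_ \<turnstile>\<^sub>S _ : _\<close> [50, 50, 50] 50) where
  "i < length \<Gamma> \<Longrightarrow> \<Gamma> \<turnstile>\<^sub>S Var i : \<Gamma> ! i"
| "\<sigma> # \<Gamma> \<turnstile>\<^sub>S t : \<tau> \<Longrightarrow> \<Gamma> \<turnstile>\<^sub>S Abs \<sigma> t : \<sigma> \<leadsto> \<tau>"
| "\<Gamma> \<turnstile>\<^sub>S t : \<sigma> \<leadsto> \<tau> \<Longrightarrow> \<Gamma> \<turnstile>\<^sub>S u : \<sigma> \<Longrightarrow> \<Gamma> \<turnstile>\<^sub>S App t u : \<tau>"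
| "c \<in> {Zero, Succ, Omega} \<union> range Rec \<Longrightarrow> \<Gamma> \<turnstile>\<^sub>S c : const_ty c"

fun cod :: "ty \<Rightarrow> ty" where
  "cod (\<sigma> \<leadsto> \<tau>) = \<tau>"
| "cod \<iota> = \<iota>"

text \<open>The unique type of a typable term, as a total function. The semantics needs it to know the
  codomain of the function denoted by an abstraction.\<close>

primrec src_ty :: "src \<Rightarrow> ty list \<Rightarrow> ty" where
  "src_ty (Var i) \<Gamma> = \<Gamma> ! i"
| "src_ty (Abs \<sigma> t) \<Gamma> = \<sigma> \<leadsto> src_ty t (\<sigma> # \<Gamma>)"
| "src_ty (App t u) \<Gamma> = cod (src_ty t \<Gamma>)"
| "src_ty Zero \<Gamma> = const_ty Zero"
| "src_ty Succ \<Gamma> = const_ty Succ"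
| "src_ty (Rec \<sigma>) \<Gamma> = const_ty (Rec \<sigma>)"
| "src_ty Omega \<Gamma> = const_ty Omega"

lemma src_ty_eq: "\<Gamma> \<turnstile>\<^sub>S u : \<sigma> \<Longrightarrow> src_ty u \<Gamma> = \<sigma>"
  by (induction rule: src_typing.induct) auto

text \<open>All types of the judgements in the typing derivation of a term, including those of the
  variables in the contexts.\<close>

fun judgement_tys :: "ty list \<Rightarrow> src \<Rightarrow> ty set" where
  "judgement_tys \<Gamma> (Abs \<sigma> t) =
     set \<Gamma> \<union> {src_ty (Abs \<sigma> t) \<Gamma>} \<union> judgement_tys (\<sigma> # \<Gamma>) t"
| "judgement_tys \<Gamma> (App t u) =
     set \<Gamma> \<union> {src_ty (App t u) \<Gamma>} \<union> judgement_tys \<Gamma> t \<union> judgement_tys \<Gamma> u"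
| "judgement_tys \<Gamma> u = set \<Gamma> \<union> {src_ty u \<Gamma>}"


section \<open>Dialogue trees\<close>

datatype 'x dtree = Leaf 'x | Node nat "nat \<Rightarrow> 'x dtree"

primrec bind :: "'x dtree \<Rightarrow> ('x \<Rightarrow> 'y dtree) \<Rightarrow> 'y dtree" where
  "bind (Leaf x) g = g x"
| "bind (Node i \<phi>) g = Node i (\<lambda>n. bind (\<phi> n) g)"

definition dmap :: "('x \<Rightarrow> 'y) \<Rightarrow> 'x dtree \<Rightarrow> 'y dtree" where
  "dmap f d = bind d (\<lambda>x. Leaf (f x))"

definition gen :: "nat dtree \<Rightarrow> nat dtree" where
  "gen d = bind d (\<lambda>i. Node i Leaf)"


section \<open>The full type hierarchy over dialogue trees\<close>

text \<open>The sets $V_\sigma$ (dialogue trees over the natural numbers at base type, all functions at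
  arrow types) form a hierarchy whose cardinalities are the iterated powers of the continuum, so no
  provably existing HOL type contains all of them. The hierarchy is therefore presented up to
  bijection: its members are coded by elements of a type \<open>'v\<close>, where \<open>base\<close> codes dialogue trees and
  \<open>ap\<close> applies (the code of) a function. The predicate \<open>full_hierarchy T H\<close> says that, for the types
  in a set \<open>T\<close> closed under components, the carriers really are all dialogue trees and
  all functions between carriers. With \<open>T = UNIV\<close> this is the complete hierarchy. For every finite
  set \<open>T\<close>, some HOL type carries such a hierarchy: see \<open>full_hierarchy_base\<close>, \<open>full_hierarchy_step\<close>
  and \<open>full_hierarchy_mono\<close> below.\<close>

record 'v hierarchy =
  carr :: "ty \<Rightarrow> 'v set"
  base :: "nat dtree \<Rightarrow> 'v"
  ap :: "'v \<Rightarrow> 'v \<Rightarrow> 'v"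

definition ty_closed :: "ty set \<Rightarrow> bool" where
  "ty_closed T \<longleftrightarrow> (\<forall>\<sigma> \<tau>. \<sigma> \<leadsto> \<tau> \<in> T \<longrightarrow> \<sigma> \<in> T \<and> \<tau> \<in> T)"

definition full_hierarchy :: "ty set \<Rightarrow> 'v hierarchy \<Rightarrow> bool" where
  "full_hierarchy T H \<longleftrightarrow>
     ty_closed T \<and>
     bij_betw (base H) UNIV (carr H \<iota>) \<and>
     (\<forall>\<sigma> \<tau>. \<sigma> \<leadsto> \<tau> \<in> T \<longrightarrow>
        bij_betw (\<lambda>h. restrict (ap H h) (carr H \<sigma>)) (carr H (\<sigma> \<leadsto> \<tau>)) (carr H \<sigma> \<rightarrow>\<^sub>E carr H \<tau>))"

definition tree_of :: "'v hierarchy \<Rightarrow> 'v \<Rightarrow> nat dtree" where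
  "tree_of H v = (THE d. base H d = v)"

text \<open>The element of $V_{\sigma\to\tau}$ that is the function \<open>F\<close>.\<close>

definition lam :: "'v hierarchy \<Rightarrow> ty \<Rightarrow> ty \<Rightarrow> ('v \<Rightarrow> 'v) \<Rightarrow> 'v" where
  "lam H \<sigma> \<tau> F = (THE h. h \<in> carr H (\<sigma> \<leadsto> \<tau>) \<and> (\<forall>a \<in> carr H \<sigma>. ap H h a = F a))"

lemma tree_of_base:
  assumes "full_hierarchy T H"
  shows "tree_of H (base H d) = d"
proof -
  have "inj (base H)"
    using assms by (auto simp: full_hierarchy_def bij_betw_def)
  then show ?thesis
    by (auto simp: tree_of_def inj_eq)
qed

lemma base_in_carr:
  assumes "full_hierarchy T H"
  shows "base H d \<in> carr H \<iota>"
  using assms by (auto simp: full_hierarchy_def bij_betw_def)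

lemma ap_in_carr:
  assumes "full_hierarchy T H" "\<sigma> \<leadsto> \<tau> \<in> T" "h \<in> carr H (\<sigma> \<leadsto> \<tau>)" "a \<in> carr H \<sigma>"
  shows "ap H h a \<in> carr H \<tau>"
proof -
  have "restrict (ap H h) (carr H \<sigma>) \<in> carr H \<sigma> \<rightarrow>\<^sub>E carr H \<tau>"
    using assms(1-3) unfolding full_hierarchy_def by (blast dest: bij_betwE)
  with assms(4) show ?thesis
    by (metis PiE_mem restrict_apply')
qed

lemma lam_unique:
  assumes H: "full_hierarchy T H" "\<sigma> \<leadsto> \<tau> \<in> T" and F: "\<And>a. a \<in> carr H \<sigma> \<Longrightarrow> F a \<in> carr H \<tau>"
  shows "\<exists>!h. h \<in> carr H (\<sigma> \<leadsto> \<tau>) \<and> (\<forall>a \<in> carr H \<sigma>. ap H h a = F a)"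
proof -
  let ?r = "\<lambda>h. restrict (ap H h) (carr H \<sigma>)"
  have bij: "bij_betw ?r (carr H (\<sigma> \<leadsto> \<tau>)) (carr H \<sigma> \<rightarrow>\<^sub>E carr H \<tau>)"
    using H by (simp add: full_hierarchy_def)
  have eq: "?r h = restrict F (carr H \<sigma>) \<longleftrightarrow> (\<forall>a \<in> carr H \<sigma>. ap H h a = F a)" for h
    by (auto simp: restrict_def fun_eq_iff)
  have "restrict F (carr H \<sigma>) \<in> carr H \<sigma> \<rightarrow>\<^sub>E carr H \<tau>"
    using F by auto
  then obtain h where h: "h \<in> carr H (\<sigma> \<leadsto> \<tau>)" "?r h = restrict F (carr H \<sigma>)"
    using bij_betw_imp_surj_on[OF bij] by (metis (no_types, lifting) imageE)
  then have "\<exists>!h. h \<in> carr H (\<sigma> \<leadsto> \<tau>) \<and> ?r h = restrict F (carr H \<sigma>)"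
    using bij_betw_imp_inj_on[OF bij] by (intro ex1I[of _ h]) (simp_all add: inj_on_def)
  then show ?thesis
    by (simp only: eq)
qed

lemma lam_in_carr:
  assumes "full_hierarchy T H" "\<sigma> \<leadsto> \<tau> \<in> T" "\<And>a. a \<in> carr H \<sigma> \<Longrightarrow> F a \<in> carr H \<tau>"
  shows "lam H \<sigma> \<tau> F \<in> carr H (\<sigma> \<leadsto> \<tau>)"
  using theI'[OF lam_unique[OF assms]] by (simp add: lam_def)

lemma ap_lam:
  assumes "full_hierarchy T H" "\<sigma> \<leadsto> \<tau> \<in> T" "\<And>a. a \<in> carr H \<sigma> \<Longrightarrow> F a \<in> carr H \<tau>"
    and "a \<in> carr H \<sigma>"
  shows "ap H (lam H \<sigma> \<tau> F) a = F a"
  using theI'[OF lam_unique[OF assms(1-3)]] assms(4) by (simp add: lam_def)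

lemma full_hierarchy_mono:
  "full_hierarchy T H \<Longrightarrow> S \<subseteq> T \<Longrightarrow> ty_closed S \<Longrightarrow> full_hierarchy S H"
  by (auto simp: full_hierarchy_def)

lemma full_hierarchy_base: "\<exists>H :: nat dtree hierarchy. full_hierarchy {\<iota>} H"
  by (rule exI[of _ "\<lparr>carr = \<lambda>_. UNIV, base = \<lambda>d. d, ap = \<lambda>_ a. a\<rparr>"])
    (auto simp: full_hierarchy_def ty_closed_def bij_betw_def)

lemma full_hierarchy_step:
  fixes H :: "'v hierarchy"
  assumes H: "full_hierarchy T H" and "\<iota> \<in> T"
  shows "\<exists>H' :: ('v + ('v \<Rightarrow> 'v)) hierarchy.
    full_hierarchy (T \<union> {\<sigma> \<leadsto> \<tau> | \<sigma> \<tau>. \<sigma> \<in> T \<and> \<tau> \<in> T}) H'"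
proof
  define C :: "ty \<Rightarrow> ('v + ('v \<Rightarrow> 'v)) set" where
    "C \<rho> = (if \<rho> \<in> T then Inl ` carr H \<rho>
       else case \<rho> of \<iota> \<Rightarrow> {} | \<sigma> \<leadsto> \<tau> \<Rightarrow> Inr ` (carr H \<sigma> \<rightarrow>\<^sub>E carr H \<tau>))" for \<rho>
  define A :: "'v + ('v \<Rightarrow> 'v) \<Rightarrow> 'v + ('v \<Rightarrow> 'v) \<Rightarrow> 'v + ('v \<Rightarrow> 'v)" where
    "A h a = Inl (case h of Inl k \<Rightarrow> ap H k (projl a) | Inr f \<Rightarrow> f (projl a))" for h a
  let ?H = "\<lparr>carr = C, base = \<lambda>d. Inl (base H d), ap = A\<rparr>"
  let ?T = "T \<union> {\<sigma> \<leadsto> \<tau> | \<sigma> \<tau>. \<sigma> \<in> T \<and> \<tau> \<in> T}"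
  have closed: "\<sigma> \<in> T \<and> \<tau> \<in> T" if "\<sigma> \<leadsto> \<tau> \<in> ?T" for \<sigma> \<tau>
    using that H unfolding full_hierarchy_def ty_closed_def by blast
  have lift: "bij_betw (\<lambda>f. restrict (\<lambda>x. Inl (f (projl x))) (Inl ` X)) (X \<rightarrow>\<^sub>E Y)
      ((Inl ` X :: ('v + ('v \<Rightarrow> 'v)) set) \<rightarrow>\<^sub>E (Inl ` Y :: ('v + ('v \<Rightarrow> 'v)) set))"
    for X Y :: "'v set"
  proof (rule bij_betw_byWitness[where f' = "\<lambda>g. restrict (\<lambda>x. projl (g (Inl x))) X"], goal_cases)
    case 1
    show ?case
    proof (intro ballI ext)
      fix f x
      assume f: "f \<in> X \<rightarrow>\<^sub>E Y"
      show "restrict (\<lambda>x. projl (restrict (\<lambda>x. Inl (f (projl x)) :: 'v + ('v \<Rightarrow> 'v)) (Inl ` X) (Inl x))) X x = f x"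
        using PiE_arb[OF f] by (cases "x \<in> X") simp_all
    qed
  next
    case 2
    show ?case
    proof (intro ballI ext)
      fix g x
      assume g: "g \<in> (Inl ` X :: ('v + ('v \<Rightarrow> 'v)) set) \<rightarrow>\<^sub>E (Inl ` Y :: ('v + ('v \<Rightarrow> 'v)) set)"
      show "restrict (\<lambda>x. Inl (restrict (\<lambda>x. projl (g (Inl x))) X (projl x))) (Inl ` X) x = g x"
      proof (cases "x \<in> Inl ` X")
        case True
        with PiE_mem[OF g True] show ?thesis by auto
      next
        case False
        with PiE_arb[OF g False] show ?thesis by simp
      qed
    qed
  next
    case 3
    show ?case
      by (rule image_subsetI, rule restrict_PiE_iff[THEN iffD2]) (auto dest: PiE_mem)
  next
    case 4
    show ?case
    proof (rule image_subsetI, rule restrict_PiE_iff[THEN iffD2], rule ballI)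
      fix g x
      assume "g \<in> (Inl ` X :: ('v + ('v \<Rightarrow> 'v)) set) \<rightarrow>\<^sub>E (Inl ` Y :: ('v + ('v \<Rightarrow> 'v)) set)" "x \<in> X"
      from PiE_mem[OF this(1) imageI[OF this(2)]] show "projl (g (Inl x)) \<in> Y" by auto
    qed
  qed
  have arrow: "bij_betw (\<lambda>h. restrict (A h) (C \<sigma>)) (C (\<sigma> \<leadsto> \<tau>)) (C \<sigma> \<rightarrow>\<^sub>E C \<tau>)"
    if "\<sigma> \<leadsto> \<tau> \<in> ?T" for \<sigma> \<tau>
  proof (cases "\<sigma> \<leadsto> \<tau> \<in> T")
    case True
    have "bij_betw projl (Inl ` carr H (\<sigma> \<leadsto> \<tau>) :: ('v + ('v \<Rightarrow> 'v)) set) (carr H (\<sigma> \<leadsto> \<tau>))"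
      by (auto simp: bij_betw_def inj_on_def image_image)
    moreover have "bij_betw (\<lambda>k. restrict (ap H k) (carr H \<sigma>)) (carr H (\<sigma> \<leadsto> \<tau>)) (carr H \<sigma> \<rightarrow>\<^sub>E carr H \<tau>)"
      using True H by (simp add: full_hierarchy_def)
    ultimately have "bij_betw ((\<lambda>k. restrict (ap H k) (carr H \<sigma>)) \<circ> projl)
        (Inl ` carr H (\<sigma> \<leadsto> \<tau>) :: ('v + ('v \<Rightarrow> 'v)) set) (carr H \<sigma> \<rightarrow>\<^sub>E carr H \<tau>)"
      by (rule bij_betw_trans)
    note bij = bij_betw_trans[OF this lift]
    have C: "C \<sigma> = Inl ` carr H \<sigma>" "C \<tau> = Inl ` carr H \<tau>" "C (\<sigma> \<leadsto> \<tau>) = Inl ` carr H (\<sigma> \<leadsto> \<tau>)"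
      using True closed[OF that] by (simp_all add: C_def)
    show ?thesis
      unfolding C by (rule bij_betw_cong[THEN iffD1, OF _ bij]) (auto simp: A_def fun_eq_iff)
  next
    case False
    have "bij_betw projr (Inr ` (carr H \<sigma> \<rightarrow>\<^sub>E carr H \<tau>) :: ('v + ('v \<Rightarrow> 'v)) set) (carr H \<sigma> \<rightarrow>\<^sub>E carr H \<tau>)"
      by (auto simp: bij_betw_def inj_on_def image_image)
    note bij = bij_betw_trans[OF this lift]
    have C: "C \<sigma> = Inl ` carr H \<sigma>" "C \<tau> = Inl ` carr H \<tau>" "C (\<sigma> \<leadsto> \<tau>) = Inr ` (carr H \<sigma> \<rightarrow>\<^sub>E carr H \<tau>)"
      using False closed[OF that] by (simp_all add: C_def)
    show ?thesis
      unfolding C by (rule bij_betw_cong[THEN iffD1, OF _ bij]) (auto simp: A_def fun_eq_iff)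
  qed
  have "ty_closed ?T"
    unfolding ty_closed_def using closed by blast
  moreover have "bij_betw (\<lambda>d. Inl (base H d)) UNIV (C \<iota>)"
    using H \<open>\<iota> \<in> T\<close> unfolding full_hierarchy_def C_def bij_betw_def inj_on_def by auto
  ultimately show "full_hierarchy ?T ?H"
    using arrow by (simp add: full_hierarchy_def)
qed

text \<open>Valuations of a context list the values of its variables in the same order.\<close>

definition valuation :: "'v hierarchy \<Rightarrow> ty list \<Rightarrow> 'v list \<Rightarrow> bool" where
  "valuation H \<Gamma> \<gamma> \<longleftrightarrow> list_all2 (\<lambda>v \<sigma>. v \<in> carr H \<sigma>) \<gamma> \<Gamma>"


section \<open>Dialogue interpretation of source terms\<close>

primrec graft :: "'v hierarchy \<Rightarrow> ty \<Rightarrow> 'x dtree \<Rightarrow> ('x \<Rightarrow> 'v) \<Rightarrow> 'v" where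
  "graft H \<iota> d g = base H (bind d (\<lambda>x. tree_of H (g x)))"
| "graft H (\<sigma> \<leadsto> \<tau>) d g = lam H \<sigma> \<tau> (\<lambda>a. graft H \<tau> d (\<lambda>x. ap H (g x) a))"

primrec iter :: "'v hierarchy \<Rightarrow> 'v \<Rightarrow> 'v \<Rightarrow> nat \<Rightarrow> 'v" where
  "iter H f a 0 = a"
| "iter H f a (Suc n) = ap H (ap H f (base H (Leaf n))) (iter H f a n)"

primrec src_sem :: "'v hierarchy \<Rightarrow> src \<Rightarrow> ty list \<Rightarrow> 'v list \<Rightarrow> 'v" where
  "src_sem H (Var i) \<Gamma> \<gamma> = \<gamma> ! i"
| "src_sem H (Abs \<sigma> t) \<Gamma> \<gamma> =
     lam H \<sigma> (src_ty t (\<sigma> # \<Gamma>)) (\<lambda>a. src_sem H t (\<sigma> # \<Gamma>) (a # \<gamma>))"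
| "src_sem H (App t u) \<Gamma> \<gamma> = ap H (src_sem H t \<Gamma> \<gamma>) (src_sem H u \<Gamma> \<gamma>)"
| "src_sem H Zero \<Gamma> \<gamma> = base H (Leaf 0)"
| "src_sem H Succ \<Gamma> \<gamma> = lam H \<iota> \<iota> (\<lambda>v. base H (dmap (\<lambda>n. n + 1) (tree_of H v)))"
| "src_sem H (Rec \<sigma>) \<Gamma> \<gamma> =
     lam H (\<iota> \<leadsto> \<sigma> \<leadsto> \<sigma>) (\<sigma> \<leadsto> \<iota> \<leadsto> \<sigma>) (\<lambda>f.
       lam H \<sigma> (\<iota> \<leadsto> \<sigma>) (\<lambda>a.
         lam H \<iota> \<sigma> (\<lambda>v. graft H \<sigma> (tree_of H v) (iter H f a))))"
| "src_sem H Omega \<Gamma> \<gamma> = lam H \<iota> \<iota> (\<lambda>v. base H (gen (tree_of H v)))"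


lemma graft_in_carr:
  assumes H: "full_hierarchy T H" and "\<sigma> \<in> T" "\<And>x. g x \<in> carr H \<sigma>"
  shows "graft H \<sigma> d g \<in> carr H \<sigma>"
  using assms(2,3)
proof (induction \<sigma> arbitrary: g)
  case Iota
  show ?case by (simp add: base_in_carr[OF H])
next
  case (Fun \<sigma> \<tau>)
  have "\<tau> \<in> T"
    using H Fun.prems(1) unfolding full_hierarchy_def ty_closed_def by blast
  then show ?case
    unfolding graft.simps using Fun.prems
    by (intro lam_in_carr[OF H] Fun.IH(2)) (auto intro: ap_in_carr[OF H])
qed

lemma src_sem_in_carr:
  assumes "\<Gamma> \<turnstile>\<^sub>S u : \<sigma>" and H: "full_hierarchy T H"
    and "judgement_tys \<Gamma> u \<subseteq> T" "valuation H \<Gamma> \<gamma>"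
  shows "src_sem H u \<Gamma> \<gamma> \<in> carr H \<sigma>"
  using assms(1,3,4)
proof (induction arbitrary: \<gamma> rule: src_typing.induct)
  case (1 i \<Gamma>)
  then show ?case by (auto simp: valuation_def list_all2_conv_all_nth)
next
  case (2 \<sigma> \<Gamma> t \<tau>)
  then show ?case
    by (auto simp: src_ty_eq valuation_def intro!: lam_in_carr[OF H])
next
  case (3 \<Gamma> t \<sigma> \<tau> u)
  have "src_ty t \<Gamma> \<in> judgement_tys \<Gamma> t" by (cases t) auto
  with 3 show ?case
    by (auto simp: src_ty_eq intro!: ap_in_carr[OF H, of \<sigma> \<tau>])
next
  case (4 c \<Gamma>)
  have closed: "\<sigma> \<in> T" "\<tau> \<in> T" if "\<sigma> \<leadsto> \<tau> \<in> T" for \<sigma> \<tau>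
    using that H unfolding full_hierarchy_def ty_closed_def by blast+
  have rec: "src_sem H (Rec \<sigma>) \<Gamma> \<gamma> \<in> carr H (const_ty (Rec \<sigma>))" if "const_ty (Rec \<sigma>) \<in> T" for \<sigma>
  proof -
    have T: "(\<iota> \<leadsto> \<sigma> \<leadsto> \<sigma>) \<leadsto> \<sigma> \<leadsto> \<iota> \<leadsto> \<sigma> \<in> T"
      using that by simp
    note T1 = closed[OF T]
    note T2 = closed[OF T1(1)] closed[OF T1(2)]
    note T3 = closed[OF T2(2)]
    have "iter H f a n \<in> carr H \<sigma>" if "f \<in> carr H (\<iota> \<leadsto> \<sigma> \<leadsto> \<sigma>)" "a \<in> carr H \<sigma>" for f a n
      using that T1 T2
      by (induction n) (auto intro!: ap_in_carr[OF H, of \<sigma> \<sigma>] ap_in_carr[OF H, of \<iota> "\<sigma> \<leadsto> \<sigma>"] base_in_carr[OF H])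
    then show ?thesis
      using T T1 T2 T3 by (auto intro!: lam_in_carr[OF H] graft_in_carr[OF H])
  qed
  from 4 rec show ?case
    by (auto intro!: lam_in_carr[OF H] base_in_carr[OF H])
qed


section \<open>Infinitary terms\<close>

datatype iterm =
    IVar nat
  | IAbs ty iterm
  | IApp iterm iterm
  | Lit nat
  | Query nat "nat \<Rightarrow> iterm"
  | Case iterm "nat \<Rightarrow> iterm"

inductive inf_typing :: "ty list \<Rightarrow> iterm \<Rightarrow> ty \<Rightarrow> bool" (\<open>_ \<turnstile>\<^sub>I _ : _\<close> [50, 50, 50] 50) where
  "i < length \<Gamma> \<Longrightarrow> \<Gamma> \<turnstile>\<^sub>I IVar i : \<Gamma> ! i"
| "\<sigma> # \<Gamma> \<turnstile>\<^sub>I M : \<tau> \<Longrightarrow> \<Gamma> \<turnstile>\<^sub>I IAbs \<sigma> M : \<sigma> \<leadsto> \<tau>"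
| "\<Gamma> \<turnstile>\<^sub>I M : \<sigma> \<leadsto> \<tau> \<Longrightarrow> \<Gamma> \<turnstile>\<^sub>I N : \<sigma> \<Longrightarrow> \<Gamma> \<turnstile>\<^sub>I IApp M N : \<tau>"
| "\<Gamma> \<turnstile>\<^sub>I Lit n : \<iota>"
| "(\<And>n. \<Gamma> \<turnstile>\<^sub>I Ms n : \<iota>) \<Longrightarrow> \<Gamma> \<turnstile>\<^sub>I Query i Ms : \<iota>"
| "\<Gamma> \<turnstile>\<^sub>I M : \<iota> \<Longrightarrow> (\<And>n. \<Gamma> \<turnstile>\<^sub>I Ms n : \<iota>) \<Longrightarrow> \<Gamma> \<turnstile>\<^sub>I Case M Ms : \<iota>"

primrec inf_ty :: "iterm \<Rightarrow> ty list \<Rightarrow> ty" where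
  "inf_ty (IVar i) \<Gamma> = \<Gamma> ! i"
| "inf_ty (IAbs \<sigma> M) \<Gamma> = \<sigma> \<leadsto> inf_ty M (\<sigma> # \<Gamma>)"
| "inf_ty (IApp M N) \<Gamma> = cod (inf_ty M \<Gamma>)"
| "inf_ty (Lit n) \<Gamma> = \<iota>"
| "inf_ty (Query i Ms) \<Gamma> = \<iota>"
| "inf_ty (Case M Ms) \<Gamma> = \<iota>"

lemma inf_ty_eq: "\<Gamma> \<turnstile>\<^sub>I M : \<sigma> \<Longrightarrow> inf_ty M \<Gamma> = \<sigma>"
  by (induction rule: inf_typing.induct) auto

primrec inf_sem :: "'v hierarchy \<Rightarrow> iterm \<Rightarrow> ty list \<Rightarrow> 'v list \<Rightarrow> 'v" where
  "inf_sem H (IVar i) \<Gamma> \<gamma> = \<gamma> ! i"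
| "inf_sem H (IAbs \<sigma> M) \<Gamma> \<gamma> =
     lam H \<sigma> (inf_ty M (\<sigma> # \<Gamma>)) (\<lambda>a. inf_sem H M (\<sigma> # \<Gamma>) (a # \<gamma>))"
| "inf_sem H (IApp M N) \<Gamma> \<gamma> = ap H (inf_sem H M \<Gamma> \<gamma>) (inf_sem H N \<Gamma> \<gamma>)"
| "inf_sem H (Lit n) \<Gamma> \<gamma> = base H (Leaf n)"
| "inf_sem H (Query i Ms) \<Gamma> \<gamma> = base H (Node i (\<lambda>n. tree_of H (inf_sem H (Ms n) \<Gamma> \<gamma>)))"
| "inf_sem H (Case M Ms) \<Gamma> \<gamma> =
     base H (bind (tree_of H (inf_sem H M \<Gamma> \<gamma>)) (\<lambda>n. tree_of H (inf_sem H (Ms n) \<Gamma> \<gamma>)))"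


section \<open>Derived selection and the translation\<close>

text \<open>\<open>lift k M\<close> inserts a fresh variable at index \<open>k\<close>.\<close>

primrec lift :: "iterm \<Rightarrow> nat \<Rightarrow> iterm" where
  "lift (IVar i) k = IVar (if i < k then i else Suc i)"
| "lift (IAbs \<sigma> M) k = IAbs \<sigma> (lift M (Suc k))"
| "lift (IApp M N) k = IApp (lift M k) (lift N k)"
| "lift (Lit n) k = Lit n"
| "lift (Query i Ms) k = Query i (\<lambda>n. lift (Ms n) k)"
| "lift (Case M Ms) k = Case (lift M k) (\<lambda>n. lift (Ms n) k)"

primrec select :: "ty \<Rightarrow> iterm \<Rightarrow> (nat \<Rightarrow> iterm) \<Rightarrow> iterm" where
  "select \<iota> M Ms = Case M Ms"
| "select (\<sigma> \<leadsto> \<tau>) M Ms = IAbs \<sigma> (select \<tau> (lift M 0) (\<lambda>n. IApp (lift (Ms n) 0) (IVar 0)))"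

primrec iter_tm :: "iterm \<Rightarrow> iterm \<Rightarrow> nat \<Rightarrow> iterm" where
  "iter_tm f a 0 = a"
| "iter_tm f a (Suc n) = IApp (IApp f (Lit n)) (iter_tm f a n)"

text \<open>Under the three binders \<open>f\<close>, \<open>a\<close>, \<open>z\<close>, these variables have the indices 2, 1, 0.\<close>

definition rec_inf :: "ty \<Rightarrow> iterm" where
  "rec_inf \<sigma> = IAbs (\<iota> \<leadsto> \<sigma> \<leadsto> \<sigma>) (IAbs \<sigma> (IAbs \<iota>
     (select \<sigma> (IVar 0) (iter_tm (IVar 2) (IVar 1)))))"

primrec hat :: "src \<Rightarrow> iterm" where
  "hat (Var i) = IVar i"
| "hat (Abs \<sigma> u) = IAbs \<sigma> (hat u)"
| "hat (App u v) = IApp (hat u) (hat v)"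
| "hat Zero = Lit 0"
| "hat Succ = IAbs \<iota> (Case (IVar 0) (\<lambda>n. Lit (n + 1)))"
| "hat (Rec \<sigma>) = rec_inf \<sigma>"
| "hat Omega = IAbs \<iota> (Case (IVar 0) (\<lambda>i. Query i Lit))"

end

theory Submission
  imports Defs
begin

text \<open>Both claims go by induction on \<open>u\<close>, and only the constants need work.
  Recursion rests on \<open>inf_sem_select\<close>: derived selection denotes typed grafting,
  because its eta-expansion at an arrow type mirrors the pointwise clause of \<open>graft\<close>.
  The new binder is harmless since weakening changes neither types nor meanings
  (\<open>lift_typing\<close>, \<open>inf_sem_lift\<close>). As \<open>iter_tm\<close> denotes
  \<open>iter\<close>, \<open>rec_inf\<close> then denotes the recursor. For \<open>Succ\<close> and
  \<open>Omega\<close> both sides are grafts of the same leaves or nodes, once decoding cancels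
  coding.\<close>

lemma lift_typing:
  assumes "\<Gamma>\<^sub>1 @ \<Gamma>\<^sub>2 \<turnstile>\<^sub>I M : \<sigma>"
  shows "\<Gamma>\<^sub>1 @ \<rho> # \<Gamma>\<^sub>2 \<turnstile>\<^sub>I lift M (length \<Gamma>\<^sub>1) : \<sigma>"
  using assms
proof (induction "\<Gamma>\<^sub>1 @ \<Gamma>\<^sub>2" M \<sigma> arbitrary: \<Gamma>\<^sub>1 rule: inf_typing.induct)
  case (1 i)
  let ?j = "if i < length \<Gamma>\<^sub>1 then i else Suc i"
  have "?j < length (\<Gamma>\<^sub>1 @ \<rho> # \<Gamma>\<^sub>2)" "(\<Gamma>\<^sub>1 @ \<Gamma>\<^sub>2) ! i = (\<Gamma>\<^sub>1 @ \<rho> # \<Gamma>\<^sub>2) ! ?j"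
    using 1 by (auto simp: nth_append Suc_diff_le)
  then show ?case
    by (metis inf_typing.intros(1) lift.simps(1))
next
  case (2 \<sigma> M \<tau>)
  \<comment> \<open>A binder extends the prefix in front of the inserted variable, hence the
    insertion at arbitrary depth.\<close>
  from 2(2)[of "\<sigma> # \<Gamma>\<^sub>1"] show ?case
    by (auto intro: inf_typing.intros)
qed (auto intro: inf_typing.intros)

lemma select_typing:
  assumes "\<Gamma> \<turnstile>\<^sub>I M : \<iota>" "\<And>n. \<Gamma> \<turnstile>\<^sub>I Ms n : \<sigma>"
  shows "\<Gamma> \<turnstile>\<^sub>I select \<sigma> M Ms : \<sigma>"
  using assms
proof (induction \<sigma> arbitrary: \<Gamma> M Ms)
  case Iota
  then show ?case by (auto intro: inf_typing.intros)
next
  case (Fun \<sigma> \<tau>)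
  have lift0: "\<sigma> # \<Gamma> \<turnstile>\<^sub>I lift N 0 : \<rho>" if "\<Gamma> \<turnstile>\<^sub>I N : \<rho>" for N \<rho>
    using lift_typing[of "[]"] that by simp
  have "\<sigma> # \<Gamma> \<turnstile>\<^sub>I IVar 0 : \<sigma>"
    using inf_typing.intros(1)[of 0 "\<sigma> # \<Gamma>"] by simp
  then have "\<sigma> # \<Gamma> \<turnstile>\<^sub>I IApp (lift (Ms n) 0) (IVar 0) : \<tau>" for n
    using lift0[OF Fun.prems(2)] by (rule inf_typing.intros(3)[rotated])
  then show ?case
    using Fun.IH(2)[OF lift0[OF Fun.prems(1)]] by (simp add: inf_typing.intros(2))
qed

lemma iter_tm_typing:
  assumes "\<Gamma> \<turnstile>\<^sub>I f : \<iota> \<leadsto> \<sigma> \<leadsto> \<sigma>" "\<Gamma> \<turnstile>\<^sub>I a : \<sigma>"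
  shows "\<Gamma> \<turnstile>\<^sub>I iter_tm f a n : \<sigma>"
  using assms by (induction n) (auto intro: inf_typing.intros)

lemma rec_inf_typing: "\<Gamma> \<turnstile>\<^sub>I rec_inf \<sigma> : const_ty (Rec \<sigma>)"
proof -
  let ?\<Delta> = "\<iota> # \<sigma> # (\<iota> \<leadsto> \<sigma> \<leadsto> \<sigma>) # \<Gamma>"
  have "?\<Delta> \<turnstile>\<^sub>I IVar 0 : \<iota>" "?\<Delta> \<turnstile>\<^sub>I IVar 1 : \<sigma>" "?\<Delta> \<turnstile>\<^sub>I IVar 2 : \<iota> \<leadsto> \<sigma> \<leadsto> \<sigma>"
    using inf_typing.intros(1)[of 0 ?\<Delta>] inf_typing.intros(1)[of 1 ?\<Delta>]
      inf_typing.intros(1)[of 2 ?\<Delta>] by simp_all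
  then show ?thesis
    by (auto simp: rec_inf_def intro!: inf_typing.intros(2) select_typing iter_tm_typing)
qed

lemma hat_typing:
  assumes "\<Gamma> \<turnstile>\<^sub>S u : \<sigma>"
  shows "\<Gamma> \<turnstile>\<^sub>I hat u : \<sigma>"
  using assms
proof (induction rule: src_typing.induct)
  case (4 c \<Gamma>)
  have "\<iota> # \<Gamma> \<turnstile>\<^sub>I IVar 0 : \<iota>"
    using inf_typing.intros(1)[of 0 "\<iota> # \<Gamma>"] by simp
  with 4 rec_inf_typing show ?case
    by (auto intro!: inf_typing.intros(2,4-6))
qed (auto intro: inf_typing.intros)

text \<open>The semantics of an abstraction reads its codomain off \<open>inf_ty\<close>, so
  semantic weakening needs this agreement first.\<close>

lemma inf_ty_lift: "inf_ty (lift M (length \<Gamma>\<^sub>1)) (\<Gamma>\<^sub>1 @ \<rho> # \<Gamma>\<^sub>2) = inf_ty M (\<Gamma>\<^sub>1 @ \<Gamma>\<^sub>2)"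
proof (induction M arbitrary: \<Gamma>\<^sub>1)
  case (IAbs \<sigma> M)
  from IAbs[of "\<sigma> # \<Gamma>\<^sub>1"] show ?case by simp
qed (auto simp: nth_append Suc_diff_le)

text \<open>Lifted indices skip the position of \<open>b\<close>; equal prefix lengths make that
  position the same in context and valuation.\<close>

lemma inf_sem_lift:
  assumes "length \<gamma>\<^sub>1 = length \<Gamma>\<^sub>1"
  shows "inf_sem H (lift M (length \<Gamma>\<^sub>1)) (\<Gamma>\<^sub>1 @ \<rho> # \<Gamma>\<^sub>2) (\<gamma>\<^sub>1 @ b # \<gamma>\<^sub>2) =
    inf_sem H M (\<Gamma>\<^sub>1 @ \<Gamma>\<^sub>2) (\<gamma>\<^sub>1 @ \<gamma>\<^sub>2)"
  using assms
proof (induction M arbitrary: \<Gamma>\<^sub>1 \<gamma>\<^sub>1)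
  case (IAbs \<sigma> M)
  have "inf_sem H (lift M (Suc (length \<Gamma>\<^sub>1))) (\<sigma> # \<Gamma>\<^sub>1 @ \<rho> # \<Gamma>\<^sub>2) (a # \<gamma>\<^sub>1 @ b # \<gamma>\<^sub>2) =
      inf_sem H M (\<sigma> # \<Gamma>\<^sub>1 @ \<Gamma>\<^sub>2) (a # \<gamma>\<^sub>1 @ \<gamma>\<^sub>2)" for a
    using IAbs.IH[of "a # \<gamma>\<^sub>1" "\<sigma> # \<Gamma>\<^sub>1"] IAbs.prems by simp
  then show ?case
    using inf_ty_lift[of M "\<sigma> # \<Gamma>\<^sub>1"] by simp
qed (auto simp: nth_append Suc_diff_le)

lemma inf_sem_lift_0: "inf_sem H (lift M 0) (\<rho> # \<Gamma>) (b # \<gamma>) = inf_sem H M \<Gamma> \<gamma>"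
  using inf_sem_lift[of "[]" "[]"] by simp

lemma inf_ty_select: "inf_ty (select \<sigma> M Ms) \<Gamma> = \<sigma>"
  by (induction \<sigma> arbitrary: M Ms \<Gamma>) simp_all

text \<open>Induction on the type. At an arrow, under a new argument \<open>a\<close>, the lifted
  scrutinee keeps its value and branch \<open>n\<close> becomes the old branch applied to
  \<open>a\<close>, which is the argument family in the clause of \<open>graft\<close>.\<close>

lemma inf_sem_select:
  "inf_sem H (select \<sigma> M Ms) \<Gamma> \<gamma> =
    graft H \<sigma> (tree_of H (inf_sem H M \<Gamma> \<gamma>)) (\<lambda>n. inf_sem H (Ms n) \<Gamma> \<gamma>)"
  by (induction \<sigma> arbitrary: M Ms \<Gamma> \<gamma>) (simp_all add: inf_ty_select inf_sem_lift_0)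

lemma inf_sem_iter_tm:
  "inf_sem H (iter_tm f a n) \<Gamma> \<gamma> = iter H (inf_sem H f \<Gamma> \<gamma>) (inf_sem H a \<Gamma> \<gamma>) n"
  by (induction n) simp_all

text \<open>Under the three binders, selection becomes \<open>graft\<close> and its branches become
  \<open>iter\<close>, leaving the same nested \<open>lam\<close>.\<close>

lemma inf_sem_rec_inf: "inf_sem H (rec_inf \<sigma>) \<Gamma> \<gamma> = src_sem H (Rec \<sigma>) \<Gamma> \<gamma>"
  by (simp add: rec_inf_def inf_ty_select inf_sem_select inf_sem_iter_tm numeral_2_eq_2)

text \<open>Gives the two \<open>lam\<close> of the abstraction case the same codomain.\<close>

lemma inf_ty_hat: "inf_ty (hat u) \<Gamma> = src_ty u \<Gamma>"
  by (induction u arbitrary: \<Gamma>) (simp_all add: rec_inf_def inf_ty_select)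

lemma inf_sem_hat:
  assumes "full_hierarchy T H"
  shows "inf_sem H (hat u) \<Gamma> \<gamma> = src_sem H u \<Gamma> \<gamma>"
  \<comment> \<open>The \<open>Rec\<close> clause stays folded so that
    \<open>inf_sem_rec_inf\<close> settles that case; \<open>tree_of_base\<close> is what matches
    the leaves under \<open>Succ\<close> and \<open>Omega\<close>.\<close>
  by (induction u arbitrary: \<Gamma> \<gamma>)
    (simp_all add: inf_ty_hat tree_of_base[OF assms] dmap_def gen_def inf_sem_rec_inf
      del: src_sem.simps(6))

theorem theorem2:
  fixes \<Gamma> :: "ty list" and u :: src and \<sigma> :: ty
  assumes "\<Gamma> \<turnstile>\<^sub>S u : \<sigma>"
  shows "\<Gamma> \<turnstile>\<^sub>I hat u : \<sigma> \<and>
    (\<forall>(T :: ty set) (H :: 'v hierarchy) (\<gamma> :: 'v list).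
       full_hierarchy T H \<longrightarrow> judgement_tys \<Gamma> u \<subseteq> T \<longrightarrow> valuation H \<Gamma> \<gamma> \<longrightarrow>
       inf_sem H (hat u) \<Gamma> \<gamma> = src_sem H u \<Gamma> \<gamma>)"
  using hat_typing[OF assms] inf_sem_hat by blast

end
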